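(* Let $E$ be an arbitrary directed graph, $K$ any field, and $H$ a nonempty hereditary subset of $E^0$. The two-sided ideal $I(H)$ of $L_K(E)$ generated by $H$ is equal, as a left $L_K(E)$-ideal, to \[\sum_{\mu\in F^+_E(H)}L_K(E)\mu^* \ =\ \bigoplus_{\mu\in F^+_E(H)}L_K(E)\mu^*\] (i.e. the sum of left ideals is direct), which in turn is isomorphic as a left $L_K(E)$-module to the external direct sum \[\bigoplus_{\mu\in F^+_E(H)}L_K(E)r(\mu).\]
   Context: Leavitt path algebra: for a directed graph $E=(E^0,E^1,s,r)$ and a field $K$, $L_K(E)$ is the associative $K$-algebra (not necessarily unital) generated by $\{u: u\in E^0\}\cup\{e,e^*: e\in E^1\}$ subject to: $uw=\delta_{u,w}u$ for $u,w\in E^0$; $s(e)e=e=e\,r(e)$ and $r(e)e^*=e^*=e^*s(e)$ for $e\in E^1$; (CK1) $e^*f=\delta_{e,f}r(e)$ for $e,f\in E^1$; (CK2) $u=\sum_{e\in s^{-1}(u)}ee^*$ for every regular vertex $u$ (i.e. $0<|s^{-1}(u)|<\infty$). Paths are vertices, or finite sequences $e_1\cdots e_m$ of edges with $r(e_i)=s(e_{i+1})$; for $\mu=e_1\cdots e_m$, $\mu^*=e_m^*\cdots e_1^*$, and $u^*=u$, $s(u)=r(u)=u$ for a vertex $u$. $H\subseteq E^0$ is hereditary if whenever $u\in H$ and there is a path from $u$ to $w$, then $w\in H$. $F^+_E(H)$ is the disjoint union of $H$ and the set of paths $e_1\cdots e_n$ ($n\ge1$) with $s(e_1)\notin H$,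 $r(e_i)\notin H$ for $1\le i<n$, and $r(e_n)\in H$. *)

theory Defs
  imports
    "HOL-Library.Poly_Mapping"
    "HOL-Algebra.QuotRing"
    "HOL-Algebra.Product_Groups"
    "Graph_Theory.Arc_Walk"
begin

section \<open>Free algebras\<close>

text \<open>The free monoid on a type of letters. It is written additively because the
  multiplication of \<^typ>\<open>'a \<Rightarrow>\<^sub>0 'k\<close> is convolution along the
  addition of \<^typ>\<open>'a\<close>; thus \<open>'x word \<Rightarrow>\<^sub>0 'k\<close> is the free associative
  unital \<open>'k\<close>-algebra on \<open>'x\<close>.\<close>

datatype 'x word = Word (letters: "'x list")

instantiation word :: (type) monoid_add
begin

definition zero_word :: "'a word" where "0 = Word []"

definition plus_word :: "'a word \<Rightarrow> 'a word \<Rightarrow> 'a word"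
  where "v + w = Word (letters v @ letters w)"

instance by standard (simp_all add: zero_word_def plus_word_def)

end

definition mono_word :: "'x list \<Rightarrow> ('x word \<Rightarrow>\<^sub>0 'k::field)"
  where "mono_word xs = Poly_Mapping.single (Word xs) 1"

definition free_algebra :: "'x set \<Rightarrow> ('x word \<Rightarrow>\<^sub>0 'k::field) ring"
  where "free_algebra X =
    \<lparr>carrier = {p. \<forall>w \<in> Poly_Mapping.keys p. set (letters w) \<subseteq> X},
     mult = (*), one = 1, zero = 0, add = (+)\<rparr>"

text \<open>The free algebra without unit: the span of the nonempty words. The \<open>one\<close> field of this
  record is not in the carrier and has no meaning; the same holds for its quotients.\<close>

definition free_nonunital_algebra :: "'x set \<Rightarrow> ('x word \<Rightarrow>\<^sub>0 'k::field) ring"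
  where "free_nonunital_algebra X =
    (free_algebra X)\<lparr>carrier := {p \<in> carrier (free_algebra X). Poly_Mapping.lookup p 0 = 0}\<rparr>"

lemma ring_free_algebra: "ring (free_algebra X :: ('x word \<Rightarrow>\<^sub>0 'k::field) ring)"
proof (rule ringI)
  let ?A = "free_algebra X :: ('x word \<Rightarrow>\<^sub>0 'k) ring"
  show "abelian_group ?A"
  proof (rule abelian_groupI)
    fix x y assume "x \<in> carrier ?A" "y \<in> carrier ?A"
    then show "x \<oplus>\<^bsub>?A\<^esub> y \<in> carrier ?A"
      using Poly_Mapping.keys_add[of x y] by (auto simp: free_algebra_def)
  next
    fix x assume "x \<in> carrier ?A"
    then show "\<exists>y\<in>carrier ?A. y \<oplus>\<^bsub>?A\<^esub> x = \<zero>\<^bsub>?A\<^esub>"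
      by (intro bexI[of _ "- x"]) (auto simp: free_algebra_def)
  qed (auto simp: free_algebra_def ac_simps)
  show "monoid ?A"
  proof (rule monoidI)
    fix x y assume xy: "x \<in> carrier ?A" "y \<in> carrier ?A"
    show "x \<otimes>\<^bsub>?A\<^esub> y \<in> carrier ?A"
      using xy keys_mult[of x y] by (fastforce simp: free_algebra_def plus_word_def)
  qed (auto simp: free_algebra_def zero_word_def mult.assoc)
qed (auto simp: free_algebra_def algebra_simps)


section \<open>Leavitt path algebras\<close>

datatype ('v, 'e) lpa_gen = Vert 'v | Edge 'e | Ghost 'e

definition lpa_gens :: "('v, 'e) pre_digraph \<Rightarrow> ('v, 'e) lpa_gen set"
  where "lpa_gens E = Vert ` verts E \<union> Edge ` arcs E \<union> Ghost ` arcs E"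

definition regular_vertex :: "('v, 'e) pre_digraph \<Rightarrow> 'v \<Rightarrow> bool"
  where "regular_vertex E u \<longleftrightarrow> u \<in> verts E \<and> out_arcs E u \<noteq> {} \<and> finite (out_arcs E u)"

text \<open>The source and range maps are \<^const>\<open>tail\<close> and \<^const>\<open>head\<close>;
  a defining equation \<open>p = q\<close> is represented by \<open>p - q\<close>.\<close>

definition lpa_relations ::
  "('v, 'e) pre_digraph \<Rightarrow> (('v, 'e) lpa_gen word \<Rightarrow>\<^sub>0 'k::field) set"
  where "lpa_relations E =
    {mono_word [Vert u, Vert w] - (if u = w then mono_word [Vert u] else 0) | u w.
        u \<in> verts E \<and> w \<in> verts E}
  \<union> {mono_word [Vert (tail E e), Edge e] - mono_word [Edge e] | e. e \<in> arcs E}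
  \<union> {mono_word [Edge e, Vert (head E e)] - mono_word [Edge e] | e. e \<in> arcs E}
  \<union> {mono_word [Vert (head E e), Ghost e] - mono_word [Ghost e] | e. e \<in> arcs E}
  \<union> {mono_word [Ghost e, Vert (tail E e)] - mono_word [Ghost e] | e. e \<in> arcs E}
  \<union> {mono_word [Ghost e, Edge f] - (if e = f then mono_word [Vert (head E e)] else 0) | e f.
        e \<in> arcs E \<and> f \<in> arcs E}
  \<union> {mono_word [Vert u] - (\<Sum>e\<in>out_arcs E u. mono_word [Edge e, Ghost e]) | u.
        regular_vertex E u}"

text \<open>The ideal is generated in the unital free algebra. It consists of elements without
  constant term, and it is the ideal that the relations generate in the \<open>'k\<close>-algebra
  \<^const>\<open>free_nonunital_algebra\<close> (closed under scalar multiplication).\<close>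

definition lpa_ideal ::
  "('v, 'e) pre_digraph \<Rightarrow> (('v, 'e) lpa_gen word \<Rightarrow>\<^sub>0 'k::field) set"
  where "lpa_ideal E = Idl\<^bsub>free_algebra (lpa_gens E)\<^esub> (lpa_relations E)"

text \<open>The argument of type \<open>'k itself\<close> only names the coefficient field. The result is in
  general a ring without unit.\<close>

definition leavitt_path_algebra ::
  "'k::field itself \<Rightarrow> ('v, 'e) pre_digraph \<Rightarrow> (('v, 'e) lpa_gen word \<Rightarrow>\<^sub>0 'k) set ring"
  where "leavitt_path_algebra K E = free_nonunital_algebra (lpa_gens E) Quot lpa_ideal E"

text \<open>The element of the Leavitt path algebra given by a product of generators.\<close>

definition lpa_mono ::
  "'k::field itself \<Rightarrow> ('v, 'e) pre_digraph \<Rightarrow> ('v, 'e) lpa_gen list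
    \<Rightarrow> (('v, 'e) lpa_gen word \<Rightarrow>\<^sub>0 'k) set"
  where "lpa_mono K E xs =
    lpa_ideal E +>\<^bsub>free_nonunital_algebra (lpa_gens E)\<^esub> mono_word xs"

abbreviation lpa_vertex ::
  "'k::field itself \<Rightarrow> ('v, 'e) pre_digraph \<Rightarrow> 'v \<Rightarrow> (('v, 'e) lpa_gen word \<Rightarrow>\<^sub>0 'k) set"
  where "lpa_vertex K E u \<equiv> lpa_mono K E [Vert u]"


section \<open>Paths and hereditary sets\<close>

text \<open>The list of edges in \<open>EdgePath\<close> is meant to be nonempty.\<close>

datatype ('v, 'e) path = VertexPath 'v | EdgePath "'e list"

fun path_range :: "('v, 'e) pre_digraph \<Rightarrow> ('v, 'e) path \<Rightarrow> 'v" where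
  "path_range E (VertexPath u) = u"
| "path_range E (EdgePath es) = head E (last es)"

fun path_star ::
  "'k::field itself \<Rightarrow> ('v, 'e) pre_digraph \<Rightarrow> ('v, 'e) path
    \<Rightarrow> (('v, 'e) lpa_gen word \<Rightarrow>\<^sub>0 'k) set" where
  "path_star K E (VertexPath u) = lpa_vertex K E u"
| "path_star K E (EdgePath es) = lpa_mono K E (map Ghost (rev es))"

definition hereditary :: "('v, 'e) pre_digraph \<Rightarrow> 'v set \<Rightarrow> bool"
  where "hereditary E H \<longleftrightarrow>
    H \<subseteq> verts E \<and> (\<forall>u\<in>H. \<forall>w. (\<exists>p. pre_digraph.awalk E u p w) \<longrightarrow> w \<in> H)"

definition F_plus :: "('v, 'e) pre_digraph \<Rightarrow> 'v set \<Rightarrow> ('v, 'e) path set"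
  where "F_plus E H =
    VertexPath ` H \<union>
    {EdgePath es | es. es \<noteq> [] \<and>
       pre_digraph.awalk E (tail E (hd es)) es (head E (last es)) \<and>
       tail E (hd es) \<notin> H \<and> (\<forall>e\<in>set (butlast es). head E e \<notin> H) \<and> head E (last es) \<in> H}"


section \<open>Ideals and modules over rings without unit\<close>

text \<open>The notions of HOL-Algebra assume a unit, e.g. \<^const>\<open>genideal\<close> is \<^const>\<open>UNIV\<close> if the
  ring has none. The following make no reference to the \<open>one\<close> field of \<open>R\<close>.\<close>

definition left_ideal :: "'a set \<Rightarrow> ('a, 'm) ring_scheme \<Rightarrow> bool"
  where "left_ideal I R \<longleftrightarrow>
    additive_subgroup I R \<and> (\<forall>a\<in>carrier R. \<forall>x\<in>I. a \<otimes>\<^bsub>R\<^esub> x \<in> I)"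

definition two_sided_ideal :: "'a set \<Rightarrow> ('a, 'm) ring_scheme \<Rightarrow> bool"
  where "two_sided_ideal I R \<longleftrightarrow>
    additive_subgroup I R \<and>
    (\<forall>a\<in>carrier R. \<forall>x\<in>I. a \<otimes>\<^bsub>R\<^esub> x \<in> I \<and> x \<otimes>\<^bsub>R\<^esub> a \<in> I)"

text \<open>Closure under scalars is not required; in a Leavitt path algebra it is automatic, since
  for every \<open>x\<close> there is a finite sum \<open>v\<close> of vertices with \<open>vx = x\<close>, so that \<open>cx = (cv)x\<close>.\<close>

definition ideal_generated :: "('a, 'm) ring_scheme \<Rightarrow> 'a set \<Rightarrow> 'a set"
  where "ideal_generated R S = \<Inter>{I. two_sided_ideal I R \<and> S \<subseteq> I}"

definition left_multiples :: "('a, 'm) ring_scheme \<Rightarrow> 'a \<Rightarrow> 'a set"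
  where "left_multiples R x = {a \<otimes>\<^bsub>R\<^esub> x | a. a \<in> carrier R}"

definition internal_sum :: "('a, 'm) ring_scheme \<Rightarrow> 'i set \<Rightarrow> ('i \<Rightarrow> 'a set) \<Rightarrow> 'a set"
  where "internal_sum R S A =
    {finsum R x T | x T. finite T \<and> T \<subseteq> S \<and> x \<in> (\<Pi> i\<in>T. A i)}"

definition sum_is_direct :: "('a, 'm) ring_scheme \<Rightarrow> 'i set \<Rightarrow> ('i \<Rightarrow> 'a set) \<Rightarrow> bool"
  where "sum_is_direct R S A \<longleftrightarrow>
    (\<forall>i\<in>S. left_ideal (A i) R) \<and>
    (\<forall>T x. finite T \<and> T \<subseteq> S \<and> x \<in> (\<Pi> i\<in>T. A i) \<and> finsum R x T = \<zero>\<^bsub>R\<^esub>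
       \<longrightarrow> (\<forall>i\<in>T. x i = \<zero>\<^bsub>R\<^esub>))"

text \<open>A left module: its additive group, in the notation of \<open>monoid\<close>, and the action.\<close>

record ('a, 'b) left_module = "'b monoid" +
  act :: "'a \<Rightarrow> 'b \<Rightarrow> 'b"

definition left_ideal_module :: "('a, 'm) ring_scheme \<Rightarrow> 'a set \<Rightarrow> ('a, 'a) left_module"
  where "left_ideal_module R I =
    \<lparr>carrier = I, mult = add R, one = zero R, act = mult R\<rparr>"

definition external_direct_sum ::
  "'i set \<Rightarrow> ('i \<Rightarrow> ('a, 'b) left_module) \<Rightarrow> ('a, 'i \<Rightarrow> 'b) left_module"
  where "external_direct_sum S M =
    monoid.extend (sum_group S M)
      (left_module.fields (\<lambda>a x. \<lambda>i\<in>S. act (M i) a (x i)))"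

definition left_module_isomorphic ::
  "('a, 'm) ring_scheme \<Rightarrow> ('a, 'b) left_module \<Rightarrow> ('a, 'c) left_module \<Rightarrow> bool"
  where "left_module_isomorphic R M N \<longleftrightarrow>
    (\<exists>h\<in>iso M N. \<forall>a\<in>carrier R. \<forall>x\<in>carrier M. h (act M a x) = act N a (h x))"

end

theory Submission
  imports Defs
begin

text \<open>For \<open>\<mu>\<close>, \<open>\<nu>\<close> in \<open>F\<close> the product \<open>\<mu>\<^sup>*\<nu>\<close> is \<open>r(\<mu>)\<close> if \<open>\<mu> = \<nu>\<close> and \<open>0\<close> otherwise, because a path
  in \<open>F\<close> ends as soon as it enters \<open>H\<close>, so that none is a proper prefix of another one. Hence right multiplication by \<open>\<mu>\<close> extracts the
  \<open>\<mu>\<close>-component of a sum of elements of the left ideals \<open>L\<mu>\<^sup>*\<close>: the sum is direct, and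
  \<open>x \<mapsto> (x\<mu>)\<close>, with inverse \<open>(b\<^sub>\<mu>) \<mapsto> \<Sum> b\<^sub>\<mu>\<mu>\<^sup>*\<close>, is the isomorphism onto the external sum of the
  \<open>Lr(\<mu>)\<close>. The sum lies in \<open>I(H)\<close> as \<open>\<mu>\<^sup>* = r(\<mu>)\<mu>\<^sup>*\<close>, and it is all of \<open>I(H)\<close> because, \<open>H\<close> being
  hereditary, \<open>\<mu>\<^sup>*g\<close> is for every generator \<open>g\<close> either \<open>0\<close> or a multiple of some \<open>\<nu>\<^sup>*\<close> with \<open>\<nu>\<close> in \<open>F\<close>.\<close>

section \<open>Rings without unit\<close>

text \<open>Leavitt path algebras of graphs with infinitely many vertices have no unit, so none of
  these axioms mentions \<open>\<one>\<close>.\<close>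

locale nonunital_ring = abelian_group R for R (structure) +
  assumes m_closed [intro, simp]: "\<lbrakk>x \<in> carrier R; y \<in> carrier R\<rbrakk> \<Longrightarrow> x \<otimes> y \<in> carrier R"
    and m_assoc: "\<lbrakk>x \<in> carrier R; y \<in> carrier R; z \<in> carrier R\<rbrakk> \<Longrightarrow> (x \<otimes> y) \<otimes> z = x \<otimes> (y \<otimes> z)"
    and l_distr: "\<lbrakk>x \<in> carrier R; y \<in> carrier R; z \<in> carrier R\<rbrakk> \<Longrightarrow> (x \<oplus> y) \<otimes> z = x \<otimes> z \<oplus> y \<otimes> z"
    and r_distr: "\<lbrakk>x \<in> carrier R; y \<in> carrier R; z \<in> carrier R\<rbrakk> \<Longrightarrow> z \<otimes> (x \<oplus> y) = z \<otimes> x \<oplus> z \<otimes> y"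
begin

lemma l_null [simp]: "x \<in> carrier R \<Longrightarrow> \<zero> \<otimes> x = \<zero>"
  using l_distr[of \<zero> \<zero> x] by (simp add: add.l_cancel_one')

lemma r_null [simp]: "x \<in> carrier R \<Longrightarrow> x \<otimes> \<zero> = \<zero>"
  using r_distr[of \<zero> \<zero> x] by (simp add: add.l_cancel_one')

lemma l_minus: "\<lbrakk>x \<in> carrier R; y \<in> carrier R\<rbrakk> \<Longrightarrow> (\<ominus> x) \<otimes> y = \<ominus> (x \<otimes> y)"
  using l_distr[of "\<ominus> x" x y] by (simp add: minus_equality l_neg)

lemma finsum_ldistr:
  "\<lbrakk>finite T; y \<in> carrier R; f \<in> T \<rightarrow> carrier R\<rbrakk> \<Longrightarrow> finsum R f T \<otimes> y = finsum R (\<lambda>i. f i \<otimes> y) T"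
  by (induction T rule: finite_induct) (auto simp: Pi_def l_distr)

lemma finsum_rdistr:
  "\<lbrakk>finite T; y \<in> carrier R; f \<in> T \<rightarrow> carrier R\<rbrakk> \<Longrightarrow> y \<otimes> finsum R f T = finsum R (\<lambda>i. y \<otimes> f i) T"
  by (induction T rule: finite_induct) (auto simp: Pi_def r_distr)

lemma additive_subgroupI':
  assumes "S \<subseteq> carrier R" "\<zero> \<in> S" "\<And>x y. \<lbrakk>x \<in> S; y \<in> S\<rbrakk> \<Longrightarrow> x \<oplus> y \<in> S"
    "\<And>x. x \<in> S \<Longrightarrow> \<ominus> x \<in> S"
  shows "additive_subgroup S R"
  by (rule additive_subgroup.intro, rule add.subgroupI) (use assms in \<open>auto simp: a_inv_def\<close>)

lemma finsum_in_additive_subgroup: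
  assumes "additive_subgroup J R" "finite T" "f \<in> T \<rightarrow> J"
  shows "finsum R f T \<in> J"
proof -
  interpret J: additive_subgroup J R by fact
  show ?thesis
    using assms(2,3) J.a_subset by (induction T rule: finite_induct) (auto simp: Pi_def subset_iff)
qed

section \<open>Left ideals and their sums\<close>

lemma left_ideal_left_multiples:
  assumes "x \<in> carrier R"
  shows "left_ideal (left_multiples R x) R"
  unfolding left_ideal_def
proof (intro conjI ballI)
  show "additive_subgroup (left_multiples R x) R"
  proof (rule additive_subgroupI')
    show "\<zero> \<in> left_multiples R x"
      using assms by (auto simp: left_multiples_def intro: exI[of _ \<zero>])
    show "y \<oplus> z \<in> left_multiples R x" if "y \<in> left_multiples R x" "z \<in> left_multiples R x" for y z
      using that assms by (auto simp: left_multiples_def l_distr[symmetric])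
    show "\<ominus> y \<in> left_multiples R x" if "y \<in> left_multiples R x" for y
      using that assms by (auto simp: left_multiples_def l_minus[symmetric])
  qed (use assms in \<open>auto simp: left_multiples_def\<close>)
  show "a \<otimes> y \<in> left_multiples R x" if "a \<in> carrier R" "y \<in> left_multiples R x" for a y
    using that assms by (auto simp: left_multiples_def m_assoc[symmetric])
qed

text \<open>Inclusions of the sum are reduced to its summands in this way, \<open>J\<close> being
  closed under finite sums.\<close>

lemma internal_sum_least:
  assumes "left_ideal J R" "\<And>i. i \<in> S \<Longrightarrow> A i \<subseteq> J"
  shows "internal_sum R S A \<subseteq> J"
  using assms
  by (auto simp: internal_sum_def left_ideal_def Pi_def subset_iff intro!: finsum_in_additive_subgroup)

lemma left_ideal_subset: "left_ideal I R \<Longrightarrow> I \<subseteq> carrier R"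
  by (simp add: left_ideal_def additive_subgroup.a_subset)

context
  fixes S :: "'i set" and A :: "'i \<Rightarrow> 'a set"
  assumes left_ideal: "\<And>i. i \<in> S \<Longrightarrow> left_ideal (A i) R"
begin

lemma additive_subgroup_summand: "i \<in> S \<Longrightarrow> additive_subgroup (A i) R"
  using left_ideal by (simp add: left_ideal_def)

lemma summand_carrier: "\<lbrakk>i \<in> S; x \<in> A i\<rbrakk> \<Longrightarrow> x \<in> carrier R"
  using left_ideal left_ideal_subset by blast

lemma summand_subset_internal_sum:
  assumes "i \<in> S"
  shows "A i \<subseteq> internal_sum R S A"
proof
  fix y assume "y \<in> A i"
  with assms summand_carrier have "finsum R (\<lambda>_. y) {i} = y" by simp
  with assms \<open>y \<in> A i\<close> show "y \<in> internal_sum R S A"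
    unfolding internal_sum_def by (intro CollectI exI[of _ "\<lambda>_. y"] exI[of _ "{i}"]) auto
qed

lemma left_ideal_internal_sum: "left_ideal (internal_sum R S A) R"
  unfolding left_ideal_def
proof (intro conjI ballI)
  note zero = additive_subgroup.zero_closed[OF additive_subgroup_summand]
  show "additive_subgroup (internal_sum R S A) R"
  proof (rule additive_subgroupI')
    show "internal_sum R S A \<subseteq> carrier R"
      using summand_carrier by (auto simp: internal_sum_def Pi_def subset_iff intro!: finsum_closed)
    show "\<zero> \<in> internal_sum R S A"
      unfolding internal_sum_def by (intro CollectI exI[of _ "\<lambda>_. \<zero>"] exI[of _ "{}"]) auto
  next
    fix y z assume "y \<in> internal_sum R S A" "z \<in> internal_sum R S A"
    then obtain f T g U where f: "y = finsum R f T" "finite T" "T \<subseteq> S" "f \<in> (\<Pi> i\<in>T. A i)"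
      and g: "z = finsum R g U" "finite U" "U \<subseteq> S" "g \<in> (\<Pi> i\<in>U. A i)"
      unfolding internal_sum_def by blast
    \<comment> \<open>The two index sets may differ; extending both families by zero to
      \<open>T \<union> U\<close> allows termwise addition.\<close>
    define f' where "f' i = (if i \<in> T then f i else \<zero>)" for i
    define g' where "g' i = (if i \<in> U then g i else \<zero>)" for i
    have f': "f' \<in> (\<Pi> i\<in>T \<union> U. A i)" and g': "g' \<in> (\<Pi> i\<in>T \<union> U. A i)"
      using f g zero by (auto simp: f'_def g'_def Pi_def subset_iff)
    have carr: "f' \<in> T \<union> U \<rightarrow> carrier R" "g' \<in> T \<union> U \<rightarrow> carrier R"
      using f' g' f(3) g(3) summand_carrier by (auto simp: Pi_def subset_iff)
    have "y = finsum R f' (T \<union> U)"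
      unfolding f(1) using f g carr
      by (intro add.finprod_mono_neutral_cong_left) (auto simp: f'_def)
    moreover have "z = finsum R g' (T \<union> U)"
      unfolding g(1) using f g carr
      by (intro add.finprod_mono_neutral_cong_left) (auto simp: g'_def)
    ultimately have "y \<oplus> z = finsum R (\<lambda>i. f' i \<oplus> g' i) (T \<union> U)"
      using carr by (simp add: finsum_addf)
    moreover have "(\<lambda>i. f' i \<oplus> g' i) \<in> (\<Pi> i\<in>T \<union> U. A i)"
      using f' g' f(3) g(3) additive_subgroup.a_closed[OF additive_subgroup_summand]
      by (auto simp: Pi_def subset_iff)
    ultimately show "y \<oplus> z \<in> internal_sum R S A"
      unfolding internal_sum_def using f(2,3) g(2,3)
      by (intro CollectI exI[of _ "\<lambda>i. f' i \<oplus> g' i"] exI[of _ "T \<union> U"]) simp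
  next
    fix y assume "y \<in> internal_sum R S A"
    then obtain f T where f: "y = finsum R f T" "finite T" "T \<subseteq> S" "f \<in> (\<Pi> i\<in>T. A i)"
      unfolding internal_sum_def by blast
    have carr: "f \<in> T \<rightarrow> carrier R"
      using f summand_carrier by (auto simp: Pi_def subset_iff)
    \<comment> \<open>The termwise negatives sum to an additive inverse of \<open>y\<close>, and
      inverses are unique.\<close>
    have "finsum R (\<lambda>i. \<ominus> f i) T \<oplus> finsum R f T = finsum R (\<lambda>i. \<ominus> f i \<oplus> f i) T"
      using carr by (subst finsum_addf) (auto simp: Pi_def)
    also have "\<dots> = \<zero>"
      using carr by (intro add.finprod_one_eqI) (auto simp: l_neg Pi_def)
    finally have "\<ominus> y = finsum R (\<lambda>i. \<ominus> f i) T"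
      using f carr by (intro minus_equality) (auto simp: Pi_def)
    moreover have "(\<lambda>i. \<ominus> f i) \<in> (\<Pi> i\<in>T. A i)"
      using f additive_subgroup.a_inv_closed[OF additive_subgroup_summand]
      by (auto simp: Pi_def subset_iff)
    ultimately show "\<ominus> y \<in> internal_sum R S A"
      unfolding internal_sum_def using f by (intro CollectI exI conjI) auto
  qed
next
  fix a y assume a: "a \<in> carrier R" and "y \<in> internal_sum R S A"
  then obtain f T where f: "y = finsum R f T" "finite T" "T \<subseteq> S" "f \<in> (\<Pi> i\<in>T. A i)"
    unfolding internal_sum_def by blast
  have carr: "f \<in> T \<rightarrow> carrier R"
    using f summand_carrier by (auto simp: Pi_def subset_iff)
  have "a \<otimes> y = finsum R (\<lambda>i. a \<otimes> f i) T"
    using a f carr by (simp add: finsum_rdistr)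
  moreover have "(\<lambda>i. a \<otimes> f i) \<in> (\<Pi> i\<in>T. A i)"
    using a f left_ideal by (auto simp: Pi_def subset_iff left_ideal_def)
  ultimately show "a \<otimes> y \<in> internal_sum R S A"
    unfolding internal_sum_def using f by (intro CollectI exI conjI) auto
qed

end

lemma group_left_ideal_module:
  assumes "left_ideal I R"
  shows "group (left_ideal_module R I)"
proof -
  interpret I: additive_subgroup I R
    using assms by (simp add: left_ideal_def)
  show ?thesis
  proof (rule groupI)
    show "\<exists>y\<in>carrier (left_ideal_module R I).
        y \<otimes>\<^bsub>left_ideal_module R I\<^esub> x = \<one>\<^bsub>left_ideal_module R I\<^esub>"
      if "x \<in> carrier (left_ideal_module R I)" for x
      using that I.a_subset
      by (intro bexI[of _ "\<ominus> x"]) (auto simp: left_ideal_module_def l_neg)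
  qed (use I.a_subset in \<open>auto simp: left_ideal_module_def a_assoc subset_iff\<close>)
qed

end

section \<open>Orthogonal systems\<close>

lemma external_direct_sum_simps:
  "carrier (external_direct_sum S M) = carrier (sum_group S M)"
  "mult (external_direct_sum S M) = mult (sum_group S M)"
  "act (external_direct_sum S M) = (\<lambda>a x. \<lambda>i\<in>S. act (M i) a (x i))"
  by (simp_all add: external_direct_sum_def monoid.defs left_module.defs)

text \<open>In the application \<open>i\<close> is a path \<mu> in \<open>F\<close>, and
  \<open>p i\<close>, \<open>q i\<close>, \<open>r i\<close> are \<mu>, its ghost path and its range
  vertex.\<close>

locale orthogonal_system = nonunital_ring +
  fixes F :: "'i set" and p q r :: "'i \<Rightarrow> 'a"
  assumes p_carrier [simp]: "i \<in> F \<Longrightarrow> p i \<in> carrier R"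
    and q_carrier [simp]: "i \<in> F \<Longrightarrow> q i \<in> carrier R"
    and r_carrier [simp]: "i \<in> F \<Longrightarrow> r i \<in> carrier R"
    and q_p: "\<lbrakk>i \<in> F; j \<in> F\<rbrakk> \<Longrightarrow> q i \<otimes> p j = (if i = j then r i else \<zero>)"
    and p_r: "i \<in> F \<Longrightarrow> p i \<otimes> r i = p i"
    and r_q: "i \<in> F \<Longrightarrow> r i \<otimes> q i = q i"
begin

lemma left_ideal_q: "i \<in> F \<Longrightarrow> left_ideal (left_multiples R (q i)) R"
  by (simp add: left_ideal_left_multiples)

lemma left_ideal_r: "i \<in> F \<Longrightarrow> left_ideal (left_multiples R (r i)) R"
  by (simp add: left_ideal_left_multiples)

text \<open>For \<open>x = a \<otimes> q i\<close> one has
  \<open>x \<otimes> p i = a \<otimes> r i\<close>, and by \<open>r_q\<close> multiplication by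
  \<open>q i\<close> gives \<open>x\<close> back. For \<open>j \<noteq> i\<close> the factor
  \<open>q i \<otimes> p j\<close> is zero.\<close>

lemma left_multiple_q:
  assumes "i \<in> F" "x \<in> left_multiples R (q i)"
  shows "x \<in> carrier R" "(x \<otimes> p i) \<otimes> q i = x" "\<And>j. \<lbrakk>j \<in> F; j \<noteq> i\<rbrakk> \<Longrightarrow> x \<otimes> p j = \<zero>"
  using assms by (auto simp: left_multiples_def m_assoc q_p r_q)

text \<open>The reverse round trip. With \<open>left_multiple_q\<close> and \<open>p_r\<close> it
  makes right multiplication by \<open>p i\<close> and by \<open>q i\<close> mutually inverse
  between the left multiples of \<open>q i\<close> and those of \<open>r i\<close>.\<close>

lemma left_multiple_r:
  assumes "i \<in> F" "x \<in> left_multiples R (r i)"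
  shows "x \<in> carrier R" "(x \<otimes> q i) \<otimes> p i = x" "x \<otimes> q i \<in> left_multiples R (q i)"
proof -
  \<comment> \<open>\<open>r i\<close> equals \<open>q i \<otimes> p i\<close>, and
    \<open>p_r\<close> absorbs the second \<open>r i\<close>.\<close>
  have "r i \<otimes> r i = r i"
    using assms(1) q_p[of i i] p_r[of i] by (metis m_assoc p_carrier q_carrier r_carrier)
  with assms show "(x \<otimes> q i) \<otimes> p i = x"
    by (auto simp: left_multiples_def m_assoc q_p)
qed (use assms in \<open>auto simp: left_multiples_def m_assoc\<close>)

text \<open>Orthogonality kills every term except the one at \<open>j\<close>. Both directness and
  the isomorphism rest on this projection.\<close>

lemma finsum_mult_p:
  assumes T: "finite T" "T \<subseteq> F" and x: "x \<in> (\<Pi> i\<in>T. left_multiples R (q i))" and j: "j \<in> F"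
  shows "finsum R x T \<otimes> p j = (if j \<in> T then x j \<otimes> p j else \<zero>)"
proof -
  have carr: "x \<in> T \<rightarrow> carrier R"
    using T x left_multiple_q(1) by (auto simp: Pi_def subset_iff)
  have "finsum R x T \<otimes> p j = finsum R (\<lambda>i. x i \<otimes> p j) T"
    using T carr j by (simp add: finsum_ldistr)
  also have "\<dots> = finsum R (\<lambda>i. if j = i then x i \<otimes> p j else \<zero>) T"
    using T carr j x left_multiple_q(3) by (intro add.finprod_cong') (auto simp: Pi_def subset_iff)
  also have "\<dots> = (if j \<in> T then x j \<otimes> p j else \<zero>)"
  proof (cases "j \<in> T")
    case True
    then show ?thesis
      using T carr j finsum_singleton[of j T "\<lambda>i. x i \<otimes> p j"] by (auto simp: Pi_def)
  next
    case False
    then show ?thesis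
      by (auto intro!: add.finprod_one_eqI)
  qed
  finally show ?thesis .
qed

lemma sum_is_direct: "sum_is_direct R F (\<lambda>i. left_multiples R (q i))"
  unfolding sum_is_direct_def
proof (intro conjI allI impI ballI)
  fix T x i
  assume "finite T \<and> T \<subseteq> F \<and> x \<in> (\<Pi> i\<in>T. left_multiples R (q i)) \<and> finsum R x T = \<zero>"
    and i: "i \<in> T"
  then have T: "finite T" "T \<subseteq> F" "x \<in> (\<Pi> i\<in>T. left_multiples R (q i))" "finsum R x T = \<zero>"
    by auto
  then have iF: "i \<in> F" and xi: "x i \<in> left_multiples R (q i)"
    using i by auto
  have "x i \<otimes> p i = \<zero>"
    using finsum_mult_p[OF T(1-3) iF] T(4) i iF by simp
  then show "x i = \<zero>"
    using left_multiple_q(2)[OF iF xi] iF by simp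
qed (rule left_ideal_q)

lemma internal_sum_isomorphic:
  "left_module_isomorphic R
     (left_ideal_module R (internal_sum R F (\<lambda>i. left_multiples R (q i))))
     (external_direct_sum F (\<lambda>i. left_ideal_module R (left_multiples R (r i))))"
  (is "left_module_isomorphic R ?M ?N")
proof -
  let ?I = "internal_sum R F (\<lambda>i. left_multiples R (q i))"
  \<comment> \<open>The restriction to \<open>F\<close> is there because elements of the external
    sum are extensional functions. In \<open>?g\<close> the sum runs over the support:
    \<open>F\<close> may be infinite, and \<open>finsum\<close> over an infinite set is zero by
    default.\<close>
  let ?h = "\<lambda>x. \<lambda>i\<in>F. x \<otimes> p i"
  let ?g = "\<lambda>b. finsum R (\<lambda>i. b i \<otimes> q i) {i \<in> F. b i \<noteq> \<zero>}"
  have I_carrier: "?I \<subseteq> carrier R"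
    by (intro left_ideal_subset left_ideal_internal_sum left_ideal_q)
  have carrN: "carrier ?N = {b \<in> \<Pi>\<^sub>E i\<in>F. left_multiples R (r i). finite {i \<in> F. b i \<noteq> \<zero>}}"
    unfolding external_direct_sum_simps
    by (subst carrier_sum_group, intro group_left_ideal_module left_ideal_r)
      (simp_all add: left_ideal_module_def)
  have h_in: "?h x \<in> carrier ?N" and g_h: "?g (?h x) = x" if "x \<in> ?I" for x
  proof -
    from that obtain f T where f: "x = finsum R f T" and T: "finite T" "T \<subseteq> F"
        "f \<in> (\<Pi> i\<in>T. left_multiples R (q i))"
      unfolding internal_sum_def by blast
    have xp: "x \<otimes> p i = (if i \<in> T then f i \<otimes> p i else \<zero>)" if "i \<in> F" for i
      unfolding f using T that by (rule finsum_mult_p)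
    have x: "x \<in> carrier R"
      using that I_carrier by blast
    have supp: "{i \<in> F. ?h x i \<noteq> \<zero>} \<subseteq> T"
      using xp by (auto split: if_splits)
    \<comment> \<open>The witness is \<open>x \<otimes> p i\<close> itself, which absorbs
      \<open>r i\<close> by \<open>p_r\<close>.\<close>
    have "x \<otimes> p i \<in> left_multiples R (r i)" if "i \<in> F" for i
      using x that unfolding left_multiples_def
      by (intro CollectI exI[of _ "x \<otimes> p i"]) (simp add: m_assoc p_r)
    then show "?h x \<in> carrier ?N"
      using finite_subset[OF supp] T by (auto simp: carrN)
    have fi: "f i \<in> carrier R \<and> f i \<otimes> p i \<otimes> q i = f i" if "i \<in> T" for i
      using that T left_multiple_q[of i "f i"] by (auto simp: Pi_def)
    have "finsum R (\<lambda>i. ?h x i \<otimes> q i) {i \<in> F. ?h x i \<noteq> \<zero>} = finsum R f T"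
    proof (rule add.finprod_mono_neutral_cong_left)
      \<comment> \<open>The support can be smaller than \<open>T\<close>, but only by indices with
        \<open>f i = \<zero>\<close>, since \<open>f i\<close> is recovered from
        \<open>f i \<otimes> p i\<close>.\<close>
      fix i assume i: "i \<in> T - {i \<in> F. ?h x i \<noteq> \<zero>}"
      then have "i \<in> F" "f i \<otimes> p i = \<zero>"
        using T(2) xp[of i] by auto
      then show "f i = \<zero>"
        using fi[of i] i by simp
    next
      fix i assume "i \<in> {i \<in> F. ?h x i \<noteq> \<zero>}"
      then show "?h x i \<otimes> q i = f i"
        using supp xp[of i] fi[of i] by auto
    qed (use T supp fi in auto)
    then show "?g (?h x) = x"
      by (simp add: f)
  qed
  have g_in: "?g b \<in> ?I" and h_g: "?h (?g b) = b" if "b \<in> carrier ?N" for b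
  proof -
    have b: "b i \<in> left_multiples R (r i)" if "i \<in> F" for i
      using that \<open>b \<in> carrier ?N\<close> by (auto simp: carrN)
    have fin: "finite {i \<in> F. b i \<noteq> \<zero>}"
      using that by (auto simp: carrN)
    have bq: "(\<lambda>i. b i \<otimes> q i) \<in> (\<Pi> i\<in>{i \<in> F. b i \<noteq> \<zero>}. left_multiples R (q i))"
      using b left_multiple_r(3) by auto
    show "?g b \<in> ?I"
      unfolding internal_sum_def using fin bq
      by (intro CollectI exI conjI) auto
    \<comment> \<open>Outside the support both sides are zero; inside, the round trip of
      \<open>left_multiple_r\<close> applies.\<close>
    have "?g b \<otimes> p j = b j" if "j \<in> F" for j
      using finsum_mult_p[OF fin _ bq that] left_multiple_r[OF that b[OF that]] that by auto
    moreover have "b \<in> extensional F"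
      using that by (auto simp: carrN PiE_iff)
    ultimately show "?h (?g b) = b"
      by (intro extensionalityI[of _ F]) simp_all
  qed
  have "bij_betw ?h ?I (carrier ?N)"
    by (rule bij_betw_byWitness[of _ ?g]) (use h_in g_h g_in h_g in blast)+
  moreover have "?h \<in> hom ?M ?N"
  proof (rule homI)
    fix x assume "x \<in> carrier ?M"
    then show "?h x \<in> carrier ?N"
      using h_in by (simp add: left_ideal_module_def)
  next
    fix x y assume "x \<in> carrier ?M" "y \<in> carrier ?M"
    then have "x \<in> carrier R" "y \<in> carrier R"
      using I_carrier by (auto simp: left_ideal_module_def)
    then show "?h (x \<otimes>\<^bsub>?M\<^esub> y) = ?h x \<otimes>\<^bsub>?N\<^esub> ?h y"
      unfolding external_direct_sum_simps mult_sum_group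
      by (intro restrict_ext) (simp add: left_ideal_module_def l_distr)
  qed
  ultimately have "?h \<in> iso ?M ?N"
    by (simp add: iso_def left_ideal_module_def)
  moreover have "?h (act ?M a x) = act ?N a (?h x)" if "a \<in> carrier R" "x \<in> carrier ?M" for a x
  proof -
    have "x \<in> carrier R"
      using that(2) I_carrier by (auto simp: left_ideal_module_def)
    then show ?thesis
      unfolding external_direct_sum_simps using that(1)
      by (intro restrict_ext) (simp add: left_ideal_module_def m_assoc)
  qed
  ultimately show ?thesis
    unfolding left_module_isomorphic_def by (intro bexI[of _ ?h] ballI)
qed

end

section \<open>Words in a Leavitt path algebra\<close>

lemma mono_word_mult: "mono_word xs * mono_word ys = (mono_word (xs @ ys) :: _ \<Rightarrow>\<^sub>0 'k::field)"
  by (simp add: mono_word_def mult_single plus_word_def)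

lemma mono_word_in_free_algebra [simp]:
  "(mono_word xs :: _ \<Rightarrow>\<^sub>0 'k::field) \<in> carrier (free_algebra X) \<longleftrightarrow> set xs \<subseteq> X"
  by (simp add: mono_word_def free_algebra_def)

lemma mono_word_in_free_nonunital_algebra [simp]:
  "(mono_word xs :: _ \<Rightarrow>\<^sub>0 'k::field) \<in> carrier (free_nonunital_algebra X) \<longleftrightarrow>
    xs \<noteq> [] \<and> set xs \<subseteq> X"
  by (auto simp: free_nonunital_algebra_def mono_word_def free_algebra_def lookup_single
      zero_word_def when_def)

lemma free_algebra_simps:
  "mult (free_algebra X) = (*)" "add (free_algebra X) = (+)" "zero (free_algebra X) = 0"
  by (simp_all add: free_algebra_def)

lemma free_algebra_closed:
  fixes a b :: "_ \<Rightarrow>\<^sub>0 'k::field"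
  assumes "a \<in> carrier (free_algebra X)" "b \<in> carrier (free_algebra X)"
  shows "a + b \<in> carrier (free_algebra X)" "a - b \<in> carrier (free_algebra X)"
    "- a \<in> carrier (free_algebra X)" "a * b \<in> carrier (free_algebra X)"
proof -
  interpret ring "free_algebra X :: (_ \<Rightarrow>\<^sub>0 'k) ring"
    by (rule ring_free_algebra)
  show "a + b \<in> carrier (free_algebra X)" "a * b \<in> carrier (free_algebra X)"
    using a_closed[OF assms] m_closed[OF assms] by (simp_all add: free_algebra_simps)
  show "a - b \<in> carrier (free_algebra X)" "- a \<in> carrier (free_algebra X)"
    using assms keys_diff[of a b] by (auto simp: free_algebra_def)
qed

lemma free_nonunital_algebra_iff:
  "a \<in> carrier (free_nonunital_algebra X) \<longleftrightarrow>
    a \<in> carrier (free_algebra X) \<and> Poly_Mapping.lookup a 0 = 0"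
  by (simp add: free_nonunital_algebra_def)

text \<open>The empty word factors only into empty words. One factor without constant term suffices,
  so that the other may later be a scalar.\<close>

lemma lookup_zero_word_mult:
  fixes a b :: "'x word \<Rightarrow>\<^sub>0 'k::field"
  assumes "Poly_Mapping.lookup a 0 = 0 \<or> Poly_Mapping.lookup b 0 = 0"
  shows "Poly_Mapping.lookup (a * b) 0 = 0"
proof (rule ccontr)
  assume "Poly_Mapping.lookup (a * b) 0 \<noteq> 0"
  then have "0 \<in> Poly_Mapping.keys (a * b)"
    by (simp add: in_keys_iff)
  then obtain v w where vw: "v \<in> Poly_Mapping.keys a" "w \<in> Poly_Mapping.keys b" "v + w = 0"
    using keys_mult[of a b] by fastforce
  then have "v = 0" "w = 0"
    by (cases v; cases w; simp add: plus_word_def zero_word_def)+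
  with vw assms show False
    by (auto simp: in_keys_iff)
qed

lemma free_nonunital_algebra_closed:
  fixes a b :: "_ \<Rightarrow>\<^sub>0 'k::field"
  assumes "a \<in> carrier (free_nonunital_algebra X)" "b \<in> carrier (free_nonunital_algebra X)"
  shows "a + b \<in> carrier (free_nonunital_algebra X)" "- a \<in> carrier (free_nonunital_algebra X)"
    "a * b \<in> carrier (free_nonunital_algebra X)"
  using assms free_algebra_closed[of a X b]
  by (simp_all add: free_nonunital_algebra_iff lookup_add lookup_zero_word_mult)

text \<open>Cosets are taken in the unital free algebra, of which \<open>lpa_ideal\<close> is an
  ideal; by \<open>coset_free_nonunital_algebra\<close> they are the same sets.\<close>

definition lpa_class ::
  "('v, 'e) pre_digraph \<Rightarrow> (('v, 'e) lpa_gen word \<Rightarrow>\<^sub>0 'k::field)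
    \<Rightarrow> (('v, 'e) lpa_gen word \<Rightarrow>\<^sub>0 'k) set"
  where "lpa_class E a = lpa_ideal E +>\<^bsub>free_algebra (lpa_gens E)\<^esub> a"

lemma coset_free_nonunital_algebra:
  "I +>\<^bsub>free_nonunital_algebra X\<^esub> a = I +>\<^bsub>free_algebra X\<^esub> a"
  by (simp add: a_r_coset_def r_coset_def free_nonunital_algebra_def)

lemma lpa_mono_eq: "lpa_mono K E xs = lpa_class E (mono_word xs)"
  by (simp add: lpa_mono_def lpa_class_def coset_free_nonunital_algebra)

lemma carrier_lpa:
  "carrier (leavitt_path_algebra K E) = lpa_class E ` carrier (free_nonunital_algebra (lpa_gens E))"
  by (auto simp: leavitt_path_algebra_def FactRing_def A_RCOSETS_def' coset_free_nonunital_algebra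
      lpa_class_def)

text \<open>Well-formedness makes the endpoints of every edge vertices, hence generators.\<close>

lemma (in wf_digraph) lpa_relations_subset:
  "(lpa_relations G :: (_ \<Rightarrow>\<^sub>0 'k::field) set) \<subseteq> carrier (free_algebra (lpa_gens G))"
proof -
  let ?A = "free_algebra (lpa_gens G) :: (_ \<Rightarrow>\<^sub>0 'k) ring"
  \<comment> \<open>This is the sum in (CK2). An infinite \<open>T\<close> is harmless because the
    sum is then zero.\<close>
  have sum: "(\<Sum>e\<in>T. mono_word [Edge e, Ghost e]) \<in> carrier ?A" if "T \<subseteq> arcs G" for T
    using that
    by (induction T rule: infinite_finite_induct)
      (auto intro!: free_algebra_closed(1) simp: lpa_gens_def, auto simp: free_algebra_def)
  have "0 \<in> carrier ?A"
    by (simp add: free_algebra_def)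
  moreover have "(\<Sum>e\<in>out_arcs G u. mono_word [Edge e, Ghost e]) \<in> carrier ?A" for u
    by (rule sum) auto
  ultimately show ?thesis
    by (auto simp: lpa_relations_def lpa_gens_def regular_vertex_def intro!: free_algebra_closed(2))
qed

lemma (in wf_digraph) ideal_lpa_ideal:
  "ideal (lpa_ideal G) (free_algebra (lpa_gens G) :: (_ \<Rightarrow>\<^sub>0 'k::field) ring)"
  unfolding lpa_ideal_def by (intro ring.genideal_ideal ring_free_algebra lpa_relations_subset)

section \<open>Ring structure of the quotient\<close>

context wf_digraph
begin

text \<open>Turns a defining relation into an equation in the quotient: \<open>a\<close> lies in the
  coset of \<open>b\<close>, and a coset is determined by any of its members.\<close>

lemma lpa_class_eqI:
  fixes a b :: "_ \<Rightarrow>\<^sub>0 'k::field"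
  assumes "a - b \<in> lpa_relations G" "b \<in> carrier (free_algebra (lpa_gens G))"
  shows "lpa_class G a = lpa_class G b"
proof -
  let ?A = "free_algebra (lpa_gens G) :: (_ \<Rightarrow>\<^sub>0 'k) ring"
  interpret ideal "lpa_ideal G" ?A
    by (rule ideal_lpa_ideal)
  have "a - b \<in> lpa_ideal G"
    unfolding lpa_ideal_def
    using assms ring.genideal_self[OF ring_free_algebra lpa_relations_subset] by blast
  then have "a \<in> lpa_ideal G +>\<^bsub>?A\<^esub> b"
    unfolding a_r_coset_def' free_algebra_simps by (intro UN_I[of "a - b"]) auto
  then show ?thesis
    unfolding lpa_class_def using assms a_repr_independence' by blast
qed

lemma lpa_class_add:
  fixes a b :: "_ \<Rightarrow>\<^sub>0 'k::field"
  assumes "a \<in> carrier (free_algebra (lpa_gens G))" "b \<in> carrier (free_algebra (lpa_gens G))"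
  shows "lpa_class G a \<oplus>\<^bsub>leavitt_path_algebra K G\<^esub> lpa_class G b = lpa_class G (a + b)"
proof -
  interpret ideal "lpa_ideal G" "free_algebra (lpa_gens G) :: (_ \<Rightarrow>\<^sub>0 'k) ring"
    by (rule ideal_lpa_ideal)
  show ?thesis
    using a_rcos_sum[OF assms]
    by (simp add: lpa_class_def leavitt_path_algebra_def FactRing_def set_add_def
        free_nonunital_algebra_def free_algebra_simps set_mult_def)
qed

text \<open>Representatives may have a constant term, so the class of \<open>1\<close>, written
  \<open>lpa_mono K G []\<close>, can serve as a factor although it is not an element of the
  algebra.\<close>

lemma lpa_class_mult:
  fixes a b :: "_ \<Rightarrow>\<^sub>0 'k::field"
  assumes "a \<in> carrier (free_algebra (lpa_gens G))" "b \<in> carrier (free_algebra (lpa_gens G))"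
  shows "lpa_class G a \<otimes>\<^bsub>leavitt_path_algebra K G\<^esub> lpa_class G b = lpa_class G (a * b)"
proof -
  interpret ideal "lpa_ideal G" "free_algebra (lpa_gens G) :: (_ \<Rightarrow>\<^sub>0 'k) ring"
    by (rule ideal_lpa_ideal)
  have "mult (free_nonunital_algebra (lpa_gens G) :: (_ \<Rightarrow>\<^sub>0 'k) ring) = (*)"
    by (simp add: free_nonunital_algebra_def free_algebra_def)
  then show ?thesis
    using rcoset_mult_add[OF assms]
    by (simp add: lpa_class_def leavitt_path_algebra_def FactRing_def rcoset_mult_def
        free_algebra_simps coset_free_nonunital_algebra)
qed

lemma zero_lpa: "\<zero>\<^bsub>leavitt_path_algebra K G\<^esub> = lpa_class G (0 :: _ \<Rightarrow>\<^sub>0 'k::field)"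
proof -
  interpret ideal "lpa_ideal G" "free_algebra (lpa_gens G) :: (_ \<Rightarrow>\<^sub>0 'k) ring"
    by (rule ideal_lpa_ideal)
  show ?thesis
    using a_coset_add_zero[OF a_subset]
    by (simp add: lpa_class_def leavitt_path_algebra_def FactRing_def free_algebra_simps)
qed

lemma nonunital_ring_lpa: "nonunital_ring (leavitt_path_algebra (K :: 'k::field itself) G)"
proof -
  let ?L = "leavitt_path_algebra K G"
  let ?N = "free_nonunital_algebra (lpa_gens G) :: (_ \<Rightarrow>\<^sub>0 'k) ring"
  note [simp] = lpa_class_add lpa_class_mult zero_lpa
  have N: "a \<in> carrier (free_algebra (lpa_gens G))" if "a \<in> carrier ?N" for a
    using that by (simp add: free_nonunital_algebra_iff)
  have "0 \<in> carrier ?N"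
    by (simp add: free_nonunital_algebra_iff free_algebra_def)
  note [simp] = this N free_nonunital_algebra_closed free_algebra_closed
  have "abelian_group ?L"
  proof (rule abelian_groupI)
    fix x assume "x \<in> carrier ?L"
    then obtain a where "x = lpa_class G a" "a \<in> carrier ?N"
      unfolding carrier_lpa by blast
    then show "\<exists>y\<in>carrier ?L. y \<oplus>\<^bsub>?L\<^esub> x = \<zero>\<^bsub>?L\<^esub>"
      by (intro bexI[of _ "lpa_class G (- a)"]) (simp_all add: carrier_lpa)
  qed (auto simp: carrier_lpa ac_simps)
  moreover have "nonunital_ring_axioms ?L"
    by unfold_locales (auto simp: carrier_lpa mult.assoc distrib_left distrib_right)
  ultimately show ?thesis
    by (rule nonunital_ring.intro)
qed

end


section \<open>Computing with generators\<close>

locale lpa = wf_digraph E for E :: "('v, 'e) pre_digraph" +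
  fixes K :: "'k::field itself"
begin

abbreviation "L \<equiv> leavitt_path_algebra K E"

abbreviation "word xs \<equiv> lpa_mono K E xs"

sublocale L: nonunital_ring L
  by (rule nonunital_ring_lpa)

lemma word_carrier: "\<lbrakk>xs \<noteq> []; set xs \<subseteq> lpa_gens E\<rbrakk> \<Longrightarrow> word xs \<in> carrier L"
  by (auto simp: carrier_lpa lpa_mono_eq)

lemma word_mult:
  "\<lbrakk>set xs \<subseteq> lpa_gens E; set ys \<subseteq> lpa_gens E\<rbrakk> \<Longrightarrow> word xs \<otimes>\<^bsub>L\<^esub> word ys = word (xs @ ys)"
  by (simp add: lpa_mono_eq lpa_class_mult mono_word_mult)

text \<open>Local rewriting: an identity of words is applied inside a longer word. Either context
  may be empty, its word then being the class of \<open>1\<close>.\<close>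

lemma word_cong:
  assumes "word ys = word ys'"
    and "set xs \<subseteq> lpa_gens E" "set ys \<subseteq> lpa_gens E" "set ys' \<subseteq> lpa_gens E" "set zs \<subseteq> lpa_gens E"
  shows "word (xs @ ys @ zs) = word (xs @ ys' @ zs)"
proof -
  have "word (xs @ ys @ zs) = word xs \<otimes>\<^bsub>L\<^esub> (word ys \<otimes>\<^bsub>L\<^esub> word zs)"
    using assms(2-) by (simp add: word_mult)
  also have "\<dots> = word (xs @ ys' @ zs)"
    unfolding assms(1) using assms(2-) by (simp add: word_mult)
  finally show ?thesis .
qed

lemma word_eq_zero:
  assumes "word ys = \<zero>\<^bsub>L\<^esub>"
    and "set xs \<subseteq> lpa_gens E" "set ys \<subseteq> lpa_gens E" "set zs \<subseteq> lpa_gens E"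
  shows "word (xs @ ys @ zs) = \<zero>\<^bsub>L\<^esub>"
proof -
  have 0: "0 \<in> carrier (free_algebra (lpa_gens E) :: (_ \<Rightarrow>\<^sub>0 'k) ring)"
    by (simp add: free_algebra_def)
  have "word (xs @ ys @ zs) = word xs \<otimes>\<^bsub>L\<^esub> (word ys \<otimes>\<^bsub>L\<^esub> word zs)"
    using assms(2-) by (simp add: word_mult)
  also have "\<dots> = \<zero>\<^bsub>L\<^esub>"
    unfolding assms(1) using assms(2-) by (simp add: lpa_mono_eq zero_lpa lpa_class_mult 0)
  finally show ?thesis .
qed

lemma gens_simps [simp]:
  "Vert u \<in> lpa_gens E \<longleftrightarrow> u \<in> verts E"
  "Edge e \<in> lpa_gens E \<longleftrightarrow> e \<in> arcs E"
  "Ghost e \<in> lpa_gens E \<longleftrightarrow> e \<in> arcs E"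
  by (auto simp: lpa_gens_def)

lemma word_Vert_Vert:
  assumes "u \<in> verts E" "w \<in> verts E"
  shows "word [Vert u, Vert w] = (if u = w then word [Vert u] else \<zero>\<^bsub>L\<^esub>)"
proof -
  have "lpa_class E (mono_word [Vert u, Vert w] :: _ \<Rightarrow>\<^sub>0 'k) =
      lpa_class E (if u = w then mono_word [Vert u] else 0)"
  proof (rule lpa_class_eqI)
    show "mono_word [Vert u, Vert w] - (if u = w then mono_word [Vert u] else 0)
        \<in> (lpa_relations E :: (_ \<Rightarrow>\<^sub>0 'k) set)"
      unfolding lpa_relations_def using assms by blast
  qed (use assms in \<open>auto simp: free_algebra_def [of "lpa_gens E"] mono_word_def\<close>)
  then show ?thesis
    by (auto simp: lpa_mono_eq zero_lpa)
qed

lemma word_Ghost_Edge: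
  assumes "e \<in> arcs E" "f \<in> arcs E"
  shows "word [Ghost e, Edge f] = (if e = f then word [Vert (head E e)] else \<zero>\<^bsub>L\<^esub>)"
proof -
  have "lpa_class E (mono_word [Ghost e, Edge f] :: _ \<Rightarrow>\<^sub>0 'k) =
      lpa_class E (if e = f then mono_word [Vert (head E e)] else 0)"
  proof (rule lpa_class_eqI)
    show "mono_word [Ghost e, Edge f] - (if e = f then mono_word [Vert (head E e)] else 0)
        \<in> (lpa_relations E :: (_ \<Rightarrow>\<^sub>0 'k) set)"
      unfolding lpa_relations_def using assms by blast
  qed (use assms in \<open>auto simp: free_algebra_def [of "lpa_gens E"] mono_word_def\<close>)
  then show ?thesis
    by (auto simp: lpa_mono_eq zero_lpa)
qed

lemma
  assumes "e \<in> arcs E"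
  shows word_tail_Edge: "word [Vert (tail E e), Edge e] = word [Edge e]"
    and word_Edge_head: "word [Edge e, Vert (head E e)] = word [Edge e]"
    and word_head_Ghost: "word [Vert (head E e), Ghost e] = word [Ghost e]"
    and word_Ghost_tail: "word [Ghost e, Vert (tail E e)] = word [Ghost e]"
  using assms unfolding lpa_mono_eq
  by (intro lpa_class_eqI; (unfold lpa_relations_def, blast)?; simp)+

text \<open>If \<open>u\<close> is not the source of \<open>e\<close>, the source is inserted in
  front of \<open>e\<close>, and orthogonality of vertices gives zero. The next three lemmas also
  insert a vertex.\<close>

lemma word_Vert_Edge:
  assumes "u \<in> verts E" "e \<in> arcs E"
  shows "word [Vert u, Edge e] = (if u = tail E e then word [Edge e] else \<zero>\<^bsub>L\<^esub>)"
proof (cases "u = tail E e")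
  case False
  have "word [Vert u, Edge e] = word [Vert u, Vert (tail E e), Edge e]"
    using word_cong[OF word_tail_Edge[OF assms(2)], of "[Vert u]" "[]"] assms by simp
  also have "\<dots> = \<zero>\<^bsub>L\<^esub>"
    using word_eq_zero[of "[Vert u, Vert (tail E e)]" "[]" "[Edge e]"] assms False
    by (simp add: word_Vert_Vert)
  finally show ?thesis
    using False by simp
qed (use assms word_tail_Edge in simp)

lemma word_Vert_Ghost:
  assumes "u \<in> verts E" "e \<in> arcs E"
  shows "word [Vert u, Ghost e] = (if u = head E e then word [Ghost e] else \<zero>\<^bsub>L\<^esub>)"
proof (cases "u = head E e")
  case False
  have "word [Vert u, Ghost e] = word [Vert u, Vert (head E e), Ghost e]"
    using word_cong[OF word_head_Ghost[OF assms(2)], of "[Vert u]" "[]"] assms by simp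
  also have "\<dots> = \<zero>\<^bsub>L\<^esub>"
    using word_eq_zero[of "[Vert u, Vert (head E e)]" "[]" "[Ghost e]"] assms False
    by (simp add: word_Vert_Vert)
  finally show ?thesis
    using False by simp
qed (use assms word_head_Ghost in simp)

lemma word_Ghost_Vert:
  assumes "u \<in> verts E" "e \<in> arcs E"
  shows "word [Ghost e, Vert u] = (if u = tail E e then word [Ghost e] else \<zero>\<^bsub>L\<^esub>)"
proof (cases "u = tail E e")
  case False
  have "word [Ghost e, Vert u] = word [Ghost e, Vert (tail E e), Vert u]"
    using word_cong[OF word_Ghost_tail[OF assms(2)], of "[]" "[Vert u]"] assms by simp
  also have "\<dots> = \<zero>\<^bsub>L\<^esub>"
    using word_eq_zero[of "[Vert (tail E e), Vert u]" "[Ghost e]" "[]"] assms False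
    by (simp add: word_Vert_Vert)
  finally show ?thesis
    using False by simp
qed (use assms word_Ghost_tail in simp)

lemma word_Ghost_Ghost:
  assumes "e \<in> arcs E" "f \<in> arcs E" "head E f \<noteq> tail E e"
  shows "word [Ghost e, Ghost f] = \<zero>\<^bsub>L\<^esub>"
proof -
  have "word [Ghost e, Ghost f] = word [Ghost e, Vert (tail E e), Ghost f]"
    using word_cong[OF word_Ghost_tail[OF assms(1)], of "[]" "[Ghost f]"] assms by simp
  also have "\<dots> = \<zero>\<^bsub>L\<^esub>"
    using word_eq_zero[of "[Vert (tail E e), Ghost f]" "[Ghost e]" "[]"] assms
    by (simp add: word_Vert_Ghost)
  finally show ?thesis .
qed

text \<open>As \<open>y\<close> is a linear combination of words, right multiplication by generators
  should suffice. A left ideal is not assumed to be closed under scalars, however; the left factor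
  \<open>a\<close> is there to absorb them.\<close>

lemma right_mult_closedI:
  assumes J: "left_ideal J L"
    and gen: "\<And>x g. \<lbrakk>x \<in> J; g \<in> lpa_gens E\<rbrakk> \<Longrightarrow> x \<otimes>\<^bsub>L\<^esub> word [g] \<in> J"
    and xs: "xs \<noteq> []" "set xs \<subseteq> lpa_gens E" "word xs \<in> J"
    and "a \<in> carrier L" "y \<in> carrier L"
  shows "(a \<otimes>\<^bsub>L\<^esub> word xs) \<otimes>\<^bsub>L\<^esub> y \<in> J"
proof -
  let ?A = "free_algebra (lpa_gens E) :: (_ \<Rightarrow>\<^sub>0 'k) ring"
  let ?N = "free_nonunital_algebra (lpa_gens E) :: (_ \<Rightarrow>\<^sub>0 'k) ring"
  interpret J: additive_subgroup J L
    using J by (simp add: left_ideal_def)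
  have N: "p \<in> carrier ?A" if "p \<in> carrier ?N" for p
    using that by (simp add: free_nonunital_algebra_iff)
  \<comment> \<open>The induction generalises over \<open>x\<close>, since splitting off the first
    letter replaces \<open>x\<close> by its product with that letter, again in
    \<open>J\<close>.\<close>
  have word: "x \<otimes>\<^bsub>L\<^esub> word ys \<in> J" if "x \<in> J" "ys \<noteq> []" "set ys \<subseteq> lpa_gens E" for x ys
    using that(2,1,3)
  proof (induction ys arbitrary: x rule: list_nonempty_induct)
    case (cons g ys)
    then have "x \<otimes>\<^bsub>L\<^esub> word (g # ys) = (x \<otimes>\<^bsub>L\<^esub> word [g]) \<otimes>\<^bsub>L\<^esub> word ys"
      using word_mult[of "[g]" ys] J.a_subset by (simp add: L.m_assoc word_carrier subset_iff)
    with cons gen show ?case by simp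
  qed (use gen in simp)
  obtain p where p: "a = lpa_class E p" "p \<in> carrier ?N"
    using \<open>a \<in> carrier L\<close> unfolding carrier_lpa by blast
  obtain q where q: "y = lpa_class E q" "q \<in> carrier ?N"
    using \<open>y \<in> carrier L\<close> unfolding carrier_lpa by blast
  have mono: "lpa_class E (p * mono_word xs * Poly_Mapping.single w c) \<in> J"
    if "w \<noteq> 0" "set (letters w) \<subseteq> lpa_gens E" for w and c :: 'k
  proof -
    define ys where "ys = letters w"
    have ys: "w = Word ys" "ys \<noteq> []" "set ys \<subseteq> lpa_gens E"
      using that by (cases w; simp add: ys_def zero_word_def)+
    let ?c = "Poly_Mapping.single 0 c :: _ \<Rightarrow>\<^sub>0 'k"
    have c: "?c \<in> carrier ?A"
      by (simp add: free_algebra_def zero_word_def)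
    \<comment> \<open>\<open>p * ?c\<close> has no constant term because \<open>p\<close> has none,
      so its class is an element of \<open>L\<close>.\<close>
    have pc: "p * ?c \<in> carrier ?A" "Poly_Mapping.lookup (p * ?c) 0 = 0"
      using free_algebra_closed(4)[OF N[OF p(2)] c] p(2)
      by (simp_all add: lookup_zero_word_mult free_nonunital_algebra_iff)
    \<comment> \<open>Scalars are not elements of \<open>L\<close>, so \<open>c\<close> is moved past \<open>xs\<close> into the left factor.\<close>
    have "mono_word xs * Poly_Mapping.single w c = ?c * (mono_word xs * mono_word ys)"
      by (simp add: mono_word_def mult_single ys(1))
    then have "lpa_class E (p * mono_word xs * Poly_Mapping.single w c) =
        lpa_class E (p * ?c * mono_word xs * mono_word ys)"
      by (simp add: mult.assoc)
    also have "\<dots> = (lpa_class E (p * ?c) \<otimes>\<^bsub>L\<^esub> word xs) \<otimes>\<^bsub>L\<^esub> word ys"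
      using pc xs ys by (simp add: lpa_mono_eq lpa_class_mult free_algebra_closed)
    also have "\<dots> \<in> J"
    proof (rule word)
      have "lpa_class E (p * ?c) \<in> carrier L"
        using pc by (simp add: carrier_lpa free_nonunital_algebra_iff)
      then show "lpa_class E (p * ?c) \<otimes>\<^bsub>L\<^esub> word xs \<in> J"
        using J xs unfolding left_ideal_def by blast
    qed (use ys in auto)
    finally show ?thesis .
  qed
  have pxs: "p * mono_word xs \<in> carrier ?A"
    using p xs N by (simp add: free_algebra_closed)
  \<comment> \<open>Partial sums of \<open>q\<close> over its support; membership in the carrier is
    carried along because \<open>lpa_class_add\<close> requires it.\<close>
  have sum: "(\<Sum>w\<in>W. Poly_Mapping.single w (Poly_Mapping.lookup q w)) \<in> carrier ?A \<and>
      lpa_class E (p * mono_word xs * (\<Sum>w\<in>W. Poly_Mapping.single w (Poly_Mapping.lookup q w))) \<in> J"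
    if "finite W" "W \<subseteq> Poly_Mapping.keys q" for W
    using that
  proof (induction W rule: finite_induct)
    case empty
    then show ?case
      using J.zero_closed by (simp add: zero_lpa free_algebra_def)
  next
    case (insert w W)
    let ?t = "Poly_Mapping.single w (Poly_Mapping.lookup q w)"
    \<comment> \<open>\<open>w\<close> is not the empty word since \<open>q\<close> has no constant
      term.\<close>
    have w: "w \<noteq> 0" "set (letters w) \<subseteq> lpa_gens E"
      using insert.prems q(2)
      by (auto simp: free_nonunital_algebra_iff free_algebra_def in_keys_iff)
    then have "?t \<in> carrier ?A"
      by (simp add: free_algebra_def)
    then show ?case
      using insert mono[OF w] pxs J.a_closed
      by (simp add: distrib_left lpa_class_add[symmetric, where K = K] free_algebra_closed)
  qed
  have "(a \<otimes>\<^bsub>L\<^esub> word xs) \<otimes>\<^bsub>L\<^esub> y = lpa_class E (p * mono_word xs * q)"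
    using p q xs N pxs by (simp add: lpa_mono_eq lpa_class_mult)
  also have "q = (\<Sum>w\<in>Poly_Mapping.keys q. Poly_Mapping.single w (Poly_Mapping.lookup q w))"
    by (intro poly_mapping_eqI) (auto simp: lookup_sum lookup_single when_def in_keys_iff)
  finally show ?thesis
    using sum by simp
qed

end

section \<open>The ideal generated by a hereditary set\<close>

locale lpa_hereditary = lpa E K for E :: "('v, 'e) pre_digraph" and K :: "'k::field itself" +
  fixes H :: "'v set"
  assumes hereditary: "hereditary E H"
begin

section \<open>Paths and ghost paths as words\<close>

abbreviation "F \<equiv> F_plus E H"

fun path_word :: "('v, 'e) path \<Rightarrow> ('v, 'e) lpa_gen list" where
  "path_word (VertexPath u) = [Vert u]"
| "path_word (EdgePath es) = map Edge es"

fun ghost_word :: "('v, 'e) path \<Rightarrow> ('v, 'e) lpa_gen list" where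
  "ghost_word (VertexPath u) = [Vert u]"
| "ghost_word (EdgePath es) = map Ghost (rev es)"

lemma path_star_eq: "path_star K E \<mu> = word (ghost_word \<mu>)"
  by (cases \<mu>) auto

lemma H_verts: "u \<in> H \<Longrightarrow> u \<in> verts E"
  using hereditary by (auto simp: hereditary_def)

lemma head_in_H: "\<lbrakk>e \<in> arcs E; tail E e \<in> H\<rbrakk> \<Longrightarrow> head E e \<in> H"
  using hereditary unfolding hereditary_def by (meson arc_implies_awalk)

lemma F_VertexPath [simp]: "VertexPath u \<in> F \<longleftrightarrow> u \<in> H"
  by (auto simp: F_plus_def)

lemma F_Nil [simp]: "EdgePath [] \<notin> F"
  by (auto simp: F_plus_def)

lemma F_single [simp]: "EdgePath [e] \<in> F \<longleftrightarrow> e \<in> arcs E \<and> tail E e \<notin> H \<and> head E e \<in> H"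
  by (auto simp: F_plus_def awalk_Cons_iff awalk_Nil_iff)

text \<open>Allows recursion along a path: as \<open>head E e = tail E f\<close>, the condition that
  \<open>e\<close> ends outside \<open>H\<close> becomes the condition that the rest starts outside
  \<open>H\<close>.\<close>

lemma F_Cons [simp]:
  "EdgePath (e # f # es) \<in> F \<longleftrightarrow>
    e \<in> arcs E \<and> tail E e \<notin> H \<and> head E e = tail E f \<and> EdgePath (f # es) \<in> F"
  by (auto simp: F_plus_def awalk_Cons_iff)

lemma F_ConsD: "EdgePath (e # es) \<in> F \<Longrightarrow> e \<in> arcs E \<and> tail E e \<notin> H"
  by (cases es) auto

lemma F_arcs: "EdgePath es \<in> F \<Longrightarrow> set es \<subseteq> arcs E"
  by (auto simp: F_plus_def)

lemma path_range_in_H: "\<mu> \<in> F \<Longrightarrow> path_range E \<mu> \<in> H"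
  by (auto simp: F_plus_def)

lemma path_word_gens: "\<mu> \<in> F \<Longrightarrow> path_word \<mu> \<noteq> [] \<and> set (path_word \<mu>) \<subseteq> lpa_gens E"
  by (cases \<mu>) (auto simp: H_verts dest: F_arcs[THEN subsetD])

lemma ghost_word_gens: "\<mu> \<in> F \<Longrightarrow> ghost_word \<mu> \<noteq> [] \<and> set (ghost_word \<mu>) \<subseteq> lpa_gens E"
  by (cases \<mu>) (auto simp: H_verts dest: F_arcs[THEN subsetD])

text \<open>The product collapses from the middle: (CK1) cancels the two first edges or gives zero,
  and the vertex left over is absorbed by the next edge of \<open>fs\<close>. As long as the edges
  agree, both paths must stop at the same time.\<close>

lemma ghost_edges_path_edges:
  "\<lbrakk>EdgePath es \<in> F; EdgePath fs \<in> F\<rbrakk> \<Longrightarrow>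
    word (map Ghost (rev es) @ map Edge fs) =
      (if es = fs then word [Vert (head E (last es))] else \<zero>\<^bsub>L\<^esub>)"
proof (induction es arbitrary: fs)
  case (Cons e es)
  from Cons.prems obtain f fs' where fs: "fs = f # fs'"
    by (cases fs) auto
  note arcs = F_arcs[OF Cons.prems(1)] F_arcs[OF Cons.prems(2)]
  have gens: "set (map Ghost (rev es)) \<subseteq> lpa_gens E" "set (map Edge fs') \<subseteq> lpa_gens E"
    "set [Ghost e, Edge f] \<subseteq> lpa_gens E" "head E e \<in> verts E"
    using arcs fs by auto
  have split: "word (map Ghost (rev (e # es)) @ map Edge fs) =
      word (map Ghost (rev es) @ [Ghost e, Edge f] @ map Edge fs')"
    by (simp add: fs)
  show ?case
  proof (cases "e = f")
    case False
    have "word [Ghost e, Edge f] = \<zero>\<^bsub>L\<^esub>"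
      using gens False by (simp add: word_Ghost_Edge)
    then show ?thesis
      unfolding split using gens False by (subst word_eq_zero) (auto simp: fs)
  next
    case True
    have "word [Ghost e, Edge f] = word [Vert (head E e)]"
      using gens True by (simp add: word_Ghost_Edge)
    then have red: "word (map Ghost (rev (e # es)) @ map Edge fs) =
        word (map Ghost (rev es) @ [Vert (head E e)] @ map Edge fs')"
      unfolding split using gens by (intro word_cong) auto
    show ?thesis
    proof (cases es)
      case Nil
      \<comment> \<open>\<open>e\<close> ends in \<open>H\<close>, so a further edge of
        \<open>fs\<close> would have its source in \<open>H\<close>, against membership in
        \<open>F\<close>.\<close>
      then have "fs' = []"
        using Cons.prems fs True by (cases fs') (auto dest: F_ConsD)
      then show ?thesis
        using red Nil True fs by simp
    next
      case (Cons e' es')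
      \<comment> \<open>Conversely \<open>e\<close> now ends outside \<open>H\<close>, so
        \<open>fs\<close> cannot stop after \<open>e\<close>.\<close>
      then obtain f' fs'' where fs': "fs' = f' # fs''"
        using Cons.prems fs True by (cases fs') (auto dest: F_ConsD)
      then have f': "tail E f' = head E e" "f' \<in> arcs E"
        using Cons.prems fs True arcs by auto
      have "word [Vert (head E e), Edge f'] = word [Edge f']"
        using word_tail_Edge[OF f'(2)] f'(1) by simp
      then have "word (map Ghost (rev es) @ [Vert (head E e), Edge f'] @ map Edge fs'') =
          word (map Ghost (rev es) @ [Edge f'] @ map Edge fs'')"
        using gens f' fs' by (intro word_cong) auto
      then have "word (map Ghost (rev (e # es)) @ map Edge fs) =
          word (map Ghost (rev es) @ map Edge fs')"
        using red fs' by simp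
      also have "\<dots> = (if es = fs' then word [Vert (head E (last es))] else \<zero>\<^bsub>L\<^esub>)"
        using Cons.prems fs fs' Cons by (intro Cons.IH) auto
      finally show ?thesis
        using Cons True fs by simp
    qed
  qed
qed simp

text \<open>The mixed products vanish because a vertex in \<open>F\<close> lies in \<open>H\<close>,
  whereas an edge path in \<open>F\<close> starts outside \<open>H\<close>.\<close>

lemma ghost_word_path_word:
  assumes "\<mu> \<in> F" "\<nu> \<in> F"
  shows "word (ghost_word \<mu>) \<otimes>\<^bsub>L\<^esub> word (path_word \<nu>) =
    (if \<mu> = \<nu> then word [Vert (path_range E \<mu>)] else \<zero>\<^bsub>L\<^esub>)"
proof -
  have "word (ghost_word \<mu>) \<otimes>\<^bsub>L\<^esub> word (path_word \<nu>) = word (ghost_word \<mu> @ path_word \<nu>)"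
    using assms by (simp add: word_mult path_word_gens ghost_word_gens)
  also have "\<dots> = (if \<mu> = \<nu> then word [Vert (path_range E \<mu>)] else \<zero>\<^bsub>L\<^esub>)"
  proof (cases \<mu>)
    case \<mu>: (VertexPath u)
    show ?thesis
    proof (cases \<nu>)
      case (VertexPath w)
      with \<mu> assms show ?thesis by (auto simp: word_Vert_Vert H_verts)
    next
      case (EdgePath fs)
      with assms obtain f fs' where fs: "fs = f # fs'"
        by (cases fs) auto
      from assms \<mu> EdgePath fs have F: "EdgePath (f # fs') \<in> F" and u: "u \<in> H"
        by simp_all
      have f: "f \<in> arcs E" "tail E f \<noteq> u" "set fs' \<subseteq> arcs E" "u \<in> verts E"
        using F_ConsD[OF F] F_arcs[OF F] H_verts[OF u] u by auto
      then have "word ([] @ [Vert u, Edge f] @ map Edge fs') = \<zero>\<^bsub>L\<^esub>"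
        by (intro word_eq_zero) (auto simp: word_Vert_Edge)
      with \<mu> EdgePath fs show ?thesis by simp
    qed
  next
    case \<mu>: (EdgePath es)
    show ?thesis
    proof (cases \<nu>)
      case (VertexPath u)
      from \<mu> assms obtain e es' where es: "es = e # es'"
        by (cases es) auto
      from assms \<mu> VertexPath es have F: "EdgePath (e # es') \<in> F" and u: "u \<in> H"
        by simp_all
      have e: "e \<in> arcs E" "tail E e \<noteq> u" "set es' \<subseteq> arcs E" "u \<in> verts E"
        using F_ConsD[OF F] F_arcs[OF F] H_verts[OF u] u by auto
      then have "word (map Ghost (rev es') @ [Ghost e, Vert u] @ []) = \<zero>\<^bsub>L\<^esub>"
        by (intro word_eq_zero) (auto simp: word_Ghost_Vert)
      with \<mu> VertexPath es show ?thesis by simp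
    next
      case (EdgePath fs)
      with \<mu> assms show ?thesis by (simp add: ghost_edges_path_edges)
    qed
  qed
  finally show ?thesis .
qed

lemma path_word_range:
  assumes "\<mu> \<in> F"
  shows "word (path_word \<mu> @ [Vert (path_range E \<mu>)]) = word (path_word \<mu>)"
proof (cases \<mu>)
  case (VertexPath u)
  with assms show ?thesis by (simp add: word_Vert_Vert H_verts)
next
  case (EdgePath es)
  with assms obtain es' e where es: "es = es' @ [e]"
    by (cases es rule: rev_cases) auto
  have e: "set es' \<subseteq> arcs E" "e \<in> arcs E"
    using F_arcs[of es] assms EdgePath es by simp_all
  then have "word (map Edge es' @ [Edge e, Vert (head E e)] @ []) = word (map Edge es' @ [Edge e] @ [])"
    by (intro word_cong word_Edge_head) auto
  with EdgePath es show ?thesis by simp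
qed

lemma range_ghost_word:
  assumes "\<mu> \<in> F"
  shows "word (Vert (path_range E \<mu>) # ghost_word \<mu>) = word (ghost_word \<mu>)"
proof (cases \<mu>)
  case (VertexPath u)
  with assms show ?thesis by (simp add: word_Vert_Vert H_verts)
next
  case (EdgePath es)
  with assms obtain es' e where es: "es = es' @ [e]"
    by (cases es rule: rev_cases) auto
  have e: "set es' \<subseteq> arcs E" "e \<in> arcs E"
    using F_arcs[of es] assms EdgePath es by simp_all
  then have "word ([] @ [Vert (head E e), Ghost e] @ map Ghost (rev es')) =
      word ([] @ [Ghost e] @ map Ghost (rev es'))"
    by (intro word_cong word_head_Ghost) auto
  with EdgePath es show ?thesis by simp
qed

text \<open>Directness and the module isomorphism thereby hold in \<open>L\<close>; what remains is
  to identify the sum with the ideal generated by \<open>H\<close>.\<close>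

sublocale orthogonal_system L F "\<lambda>\<mu>. word (path_word \<mu>)" "\<lambda>\<mu>. word (ghost_word \<mu>)"
  "\<lambda>\<mu>. word [Vert (path_range E \<mu>)]"
proof
  fix \<mu> assume "\<mu> \<in> F"
  note \<mu> = this path_word_gens[OF this] ghost_word_gens[OF this] H_verts[OF path_range_in_H[OF this]]
  show "word (path_word \<mu>) \<in> carrier L" "word (ghost_word \<mu>) \<in> carrier L"
    "word [Vert (path_range E \<mu>)] \<in> carrier L"
    using \<mu> by (auto intro!: word_carrier)
  show "word (path_word \<mu>) \<otimes>\<^bsub>L\<^esub> word [Vert (path_range E \<mu>)] = word (path_word \<mu>)"
    using \<mu> by (simp add: word_mult path_word_range)
  show "word [Vert (path_range E \<mu>)] \<otimes>\<^bsub>L\<^esub> word (ghost_word \<mu>) = word (ghost_word \<mu>)"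
    using \<mu> by (simp add: word_mult range_ghost_word)
qed (rule ghost_word_path_word)

section \<open>The sum of the left ideals of ghost paths\<close>

abbreviation "ghost_sum \<equiv> internal_sum L F (\<lambda>\<mu>. left_multiples L (word (ghost_word \<mu>)))"

lemma left_ideal_ghost_sum: "left_ideal ghost_sum L"
  by (intro L.left_ideal_internal_sum left_ideal_q)

text \<open>Without a unit, a ghost path is not obviously a left multiple of itself. Inserting its
  range vertex provides a nonempty left factor even for empty \<open>xs\<close>.\<close>

lemma word_in_ghost_sum:
  assumes "\<nu> \<in> F" "set xs \<subseteq> lpa_gens E"
  shows "word (xs @ ghost_word \<nu>) \<in> ghost_sum"
proof -
  let ?r = "[Vert (path_range E \<nu>)]"
  note \<nu> = ghost_word_gens[OF assms(1)] H_verts[OF path_range_in_H[OF assms(1)]]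
  have "word (xs @ (?r @ ghost_word \<nu>) @ []) = word (xs @ ghost_word \<nu> @ [])"
    using assms \<nu> by (intro word_cong) (simp_all add: range_ghost_word)
  then have "word (xs @ ghost_word \<nu>) = word (xs @ ?r) \<otimes>\<^bsub>L\<^esub> word (ghost_word \<nu>)"
    using assms \<nu> by (simp add: word_mult)
  moreover have "word (xs @ ?r) \<in> carrier L"
    using assms \<nu> by (intro word_carrier) auto
  ultimately have "word (xs @ ghost_word \<nu>) \<in> left_multiples L (word (ghost_word \<nu>))"
    by (auto simp: left_multiples_def)
  then show ?thesis
    using L.summand_subset_internal_sum[of F "\<lambda>\<mu>. left_multiples L (word (ghost_word \<mu>))"]
      left_ideal_q assms(1) by blast
qed

lemma zero_in_ghost_sum: "\<zero>\<^bsub>L\<^esub> \<in> ghost_sum"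
  using left_ideal_ghost_sum by (simp add: left_ideal_def additive_subgroup.zero_closed)

text \<open>Each case looks at the two letters where the ghost path meets \<open>g\<close>. The
  outcome is zero or a word ending in the ghost path of a member of \<open>F\<close>.\<close>

lemma ghost_word_generator:
  assumes \<mu>: "\<mu> \<in> F" and g: "g \<in> lpa_gens E"
  shows "word (ghost_word \<mu> @ [g]) \<in> ghost_sum"
proof (cases \<mu>)
  case (VertexPath u)
  with \<mu> have u: "u \<in> H" "u \<in> verts E"
    by (simp_all add: H_verts)
  have "word [Vert u, g] \<in> ghost_sum"
  proof (cases g)
    case (Vert w)
    with g have "word [Vert u, g] = (if u = w then word [Vert u] else \<zero>\<^bsub>L\<^esub>)"
      using u by (simp add: word_Vert_Vert)
    then show ?thesis
      using zero_in_ghost_sum word_in_ghost_sum[of "VertexPath u" "[]"] u by (cases "u = w") simp_all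
  next
    case (Edge e)
    with g have e: "e \<in> arcs E" by simp
    show ?thesis
    proof (cases "u = tail E e")
      case True
      \<comment> \<open>Heredity puts \<open>head E e\<close> into \<open>H\<close>, so the product
        is a left multiple of a vertex of \<open>H\<close>.\<close>
      then have "word [Vert u, g] = word [Edge e, Vert (head E e)]"
        using Edge e by (simp add: word_tail_Edge word_Edge_head)
      then show ?thesis
        using word_in_ghost_sum[of "VertexPath (head E e)" "[Edge e]"] True e u head_in_H by simp
    qed (use Edge e u zero_in_ghost_sum in \<open>simp add: word_Vert_Edge\<close>)
  next
    case (Ghost e)
    with g have e: "e \<in> arcs E" by simp
    show ?thesis
    proof (cases "u = head E e")
      case True
      then have red: "word [Vert u, g] = word [Ghost e]"
        using Ghost e by (simp add: word_head_Ghost)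
      show ?thesis
      \<comment> \<open>The one-edge path \<open>[e]\<close> is in \<open>F\<close> only if it
        starts outside \<open>H\<close>; otherwise the ghost edge is a left multiple of its source,
        a vertex of \<open>H\<close>.\<close>
      proof (cases "tail E e \<in> H")
        case True
        then show ?thesis
          using word_in_ghost_sum[of "VertexPath (tail E e)" "[Ghost e]"] red e
          by (simp add: word_Ghost_tail)
      next
        case False
        then show ?thesis
          using word_in_ghost_sum[of "EdgePath [e]" "[]"] red e u \<open>u = head E e\<close> by simp
      qed
    qed (use Ghost e u zero_in_ghost_sum in \<open>simp add: word_Vert_Ghost\<close>)
  qed
  with VertexPath show ?thesis by simp
next
  case (EdgePath es)
  with \<mu> obtain f fs where es: "es = f # fs"
    by (cases es) auto
  have F: "EdgePath (f # fs) \<in> F"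
    using \<mu> EdgePath es by simp
  have f: "f \<in> arcs E" "tail E f \<notin> H"
    and fs: "set (map Ghost (rev fs)) \<subseteq> lpa_gens E" "set fs \<subseteq> arcs E"
    using F_ConsD[OF F] F_arcs[OF F] by auto
  have reduce: "word (map Ghost (rev fs) @ [Ghost f, g] @ []) = word (map Ghost (rev fs) @ ys @ [])"
    if "word [Ghost f, g] = word ys" "set ys \<subseteq> lpa_gens E" for ys
    using that fs f g by (intro word_cong) simp_all
  have zero: "word (map Ghost (rev fs) @ [Ghost f, g] @ []) \<in> ghost_sum"
    if "word [Ghost f, g] = \<zero>\<^bsub>L\<^esub>"
    using word_eq_zero[OF that fs(1), of "[]"] f g zero_in_ghost_sum by simp
  have "word (map Ghost (rev fs) @ [Ghost f, g] @ []) \<in> ghost_sum"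
  proof (cases g)
    case (Vert w)
    show ?thesis
    proof (cases "w = tail E f")
      case True
      then have "word [Ghost f, g] = word [Ghost f]"
        using Vert f by (simp add: word_Ghost_tail)
      from reduce[OF this] show ?thesis
        using word_in_ghost_sum[OF F, of "[]"] f by simp
    next
      case False
      with Vert f g show ?thesis by (intro zero) (simp add: word_Ghost_Vert)
    qed
  next
    case (Edge e)
    show ?thesis
    proof (cases "e = f")
      case True
      then have "word [Ghost f, g] = word [Vert (head E f)]"
        using Edge f by (simp add: word_Ghost_Edge)
      from reduce[OF this]
      have red: "word (map Ghost (rev fs) @ [Ghost f, g] @ []) =
          word (map Ghost (rev fs) @ [Vert (head E f)])"
        using f by simp
      show ?thesis
      \<comment> \<open>(CK1) has removed the first edge \<open>f\<close>. If no edge remains, its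
        head is a vertex of \<open>H\<close>; otherwise the head is absorbed and the ghost path of
        \<open>fs\<close> is left.\<close>
      proof (cases fs)
        case Nil
        with F red show ?thesis
          using word_in_ghost_sum[of "VertexPath (head E f)" "[]"] by simp
      next
        case (Cons f' fs')
        with F have f': "head E f = tail E f'" "EdgePath fs \<in> F"
          by simp_all
        have "word (map Ghost (rev fs') @ [Ghost f', Vert (tail E f')] @ []) =
            word (map Ghost (rev fs') @ [Ghost f'] @ [])"
          using fs Cons by (intro word_cong word_Ghost_tail) auto
        then have "word (map Ghost (rev fs) @ [Vert (head E f)]) = word (ghost_word (EdgePath fs))"
          using Cons f'(1) by simp
        then show ?thesis
          using red word_in_ghost_sum[OF f'(2), of "[]"] by simp
      qed
    next
      case False
      with Edge f g show ?thesis by (intro zero) (simp add: word_Ghost_Edge)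
    qed
  next
    case (Ghost e)
    show ?thesis
    proof (cases "head E e = tail E f")
      case True
      \<comment> \<open>The path is prolonged at its start: as \<open>f\<close> starts outside
        \<open>H\<close>, heredity forces the source of \<open>e\<close> to lie outside
        \<open>H\<close>.\<close>
      then have "EdgePath (e # f # fs) \<in> F"
        using F f g Ghost head_in_H[of e] by auto
      from word_in_ghost_sum[OF this, of "[]"] show ?thesis
        using Ghost by simp
    next
      case False
      with Ghost f g show ?thesis by (intro zero) (simp add: word_Ghost_Ghost)
    qed
  qed
  with EdgePath es show ?thesis by simp
qed

text \<open>Makes \<open>internal_sum_least\<close> applicable: to see that right multiplication by
  \<open>y\<close> preserves the sum, it is enough to treat left multiples of single ghost
  paths.\<close>

lemma left_ideal_right_quotient:
  assumes "y \<in> carrier L"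
  shows "left_ideal {x \<in> carrier L. x \<otimes>\<^bsub>L\<^esub> y \<in> ghost_sum} L"
proof -
  interpret S: additive_subgroup ghost_sum L
    using left_ideal_ghost_sum by (simp add: left_ideal_def)
  show ?thesis
    unfolding left_ideal_def
  proof (intro conjI L.additive_subgroupI' ballI)
    fix a x assume "a \<in> carrier L" "x \<in> {x \<in> carrier L. x \<otimes>\<^bsub>L\<^esub> y \<in> ghost_sum}"
    then show "a \<otimes>\<^bsub>L\<^esub> x \<in> {x \<in> carrier L. x \<otimes>\<^bsub>L\<^esub> y \<in> ghost_sum}"
      using left_ideal_ghost_sum assms by (simp add: left_ideal_def L.m_assoc)
  qed (use assms in \<open>auto simp: L.l_distr L.l_minus\<close>)
qed

lemma ghost_sum_mult_generator:
  assumes "x \<in> ghost_sum" "g \<in> lpa_gens E"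
  shows "x \<otimes>\<^bsub>L\<^esub> word [g] \<in> ghost_sum"
proof -
  have g: "word [g] \<in> carrier L"
    using assms by (intro word_carrier) auto
  have "(a \<otimes>\<^bsub>L\<^esub> word (ghost_word \<mu>)) \<otimes>\<^bsub>L\<^esub> word [g] \<in> ghost_sum"
    if "\<mu> \<in> F" "a \<in> carrier L" for a \<mu>
  proof -
    have "(a \<otimes>\<^bsub>L\<^esub> word (ghost_word \<mu>)) \<otimes>\<^bsub>L\<^esub> word [g] = a \<otimes>\<^bsub>L\<^esub> word (ghost_word \<mu> @ [g])"
      using that g assms by (simp add: L.m_assoc word_mult ghost_word_gens)
    then show ?thesis
      using ghost_word_generator[OF that(1) assms(2)] left_ideal_ghost_sum that
      by (simp add: left_ideal_def)
  qed
  then have "ghost_sum \<subseteq> {x \<in> carrier L. x \<otimes>\<^bsub>L\<^esub> word [g] \<in> ghost_sum}"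
    by (intro L.internal_sum_least left_ideal_right_quotient g) (auto simp: left_multiples_def)
  with assms show ?thesis by blast
qed

text \<open>Elements of the summands have the form that \<open>right_mult_closedI\<close> requires,
  a left factor times a word lying in the sum.\<close>

lemma ghost_sum_mult:
  assumes "x \<in> ghost_sum" "y \<in> carrier L"
  shows "x \<otimes>\<^bsub>L\<^esub> y \<in> ghost_sum"
proof -
  have "(a \<otimes>\<^bsub>L\<^esub> word (ghost_word \<mu>)) \<otimes>\<^bsub>L\<^esub> y \<in> ghost_sum" if "\<mu> \<in> F" "a \<in> carrier L" for a \<mu>
    using that assms(2) word_in_ghost_sum[OF that(1), of "[]"] ghost_word_gens
    by (intro right_mult_closedI left_ideal_ghost_sum ghost_sum_mult_generator) auto
  then have "ghost_sum \<subseteq> {x \<in> carrier L. x \<otimes>\<^bsub>L\<^esub> y \<in> ghost_sum}"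
    by (intro L.internal_sum_least left_ideal_right_quotient assms) (auto simp: left_multiples_def)
  with assms show ?thesis by blast
qed

text \<open>One inclusion holds because a vertex of \<open>H\<close> is a member of \<open>F\<close>
  and its own ghost path; for the other, every two-sided ideal containing the vertices of
  \<open>H\<close> contains all ghost paths by \<open>r_q\<close>.\<close>

lemma ideal_generated_H: "ideal_generated L (lpa_vertex K E ` H) = ghost_sum"
proof
  have "two_sided_ideal ghost_sum L"
    using left_ideal_ghost_sum ghost_sum_mult by (auto simp: two_sided_ideal_def left_ideal_def)
  moreover have "lpa_vertex K E ` H \<subseteq> ghost_sum"
    using word_in_ghost_sum[of "VertexPath _" "[]"] by auto
  ultimately show "ideal_generated L (lpa_vertex K E ` H) \<subseteq> ghost_sum"
    unfolding ideal_generated_def by blast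
next
  have "ghost_sum \<subseteq> J" if J: "two_sided_ideal J L" "lpa_vertex K E ` H \<subseteq> J" for J
  proof (rule L.internal_sum_least)
    show "left_ideal J L"
      using J by (simp add: two_sided_ideal_def left_ideal_def)
    fix \<mu> assume \<mu>: "\<mu> \<in> F"
    then have "word [Vert (path_range E \<mu>)] \<otimes>\<^bsub>L\<^esub> word (ghost_word \<mu>) \<in> J"
      using J path_range_in_H[OF \<mu>] unfolding two_sided_ideal_def by auto
    then have "word (ghost_word \<mu>) \<in> J"
      using r_q[OF \<mu>] by simp
    then show "left_multiples L (word (ghost_word \<mu>)) \<subseteq> J"
      using J by (auto simp: left_multiples_def two_sided_ideal_def)
  qed
  then show "ghost_sum \<subseteq> ideal_generated L (lpa_vertex K E ` H)"
    unfolding ideal_generated_def by blast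
qed

end

theorem proposition3p4:
  fixes K :: "'k::field itself"
    and E :: "('v, 'e) pre_digraph"
    and H :: "'v set"
  assumes "wf_digraph E"
    and "hereditary E H"
    and "H \<noteq> {}"
  shows "let L = leavitt_path_algebra K E;
             I = ideal_generated L (lpa_vertex K E ` H);
             F = F_plus E H
         in left_ideal I L
          \<and> I = internal_sum L F (\<lambda>\<mu>. left_multiples L (path_star K E \<mu>))
          \<and> sum_is_direct L F (\<lambda>\<mu>. left_multiples L (path_star K E \<mu>))
          \<and> left_module_isomorphic L (left_ideal_module L I)
               (external_direct_sum F
                 (\<lambda>\<mu>. left_ideal_module L (left_multiples L (lpa_vertex K E (path_range E \<mu>)))))"
proof -
  interpret lpa_hereditary E K H
    using assms(1,2) by (simp add: lpa_hereditary_def lpa_def lpa_hereditary_axioms_def)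
  show ?thesis
    unfolding Let_def ideal_generated_H path_star_eq
    using left_ideal_ghost_sum sum_is_direct internal_sum_isomorphic by simp
qed

end
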